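(* As $q\to\infty$ or $n\to\infty$ (with $n\ge 1$ and $q\ge 2$ integers), $$ f(n,q) \geq \sqrt{\frac{2q^{2^n}}{q^{(n+1)}e^{\left(\frac{n-1}{q-1}\right)}}} - 1 = q^{2^{(n-1)}(1+o(1))}. $$
   Context: A word is a finite string of letters; a word is $q$-ary if at most $q$ distinct letters occur in it. A factor of a word is a string of consecutive letters of it. A homomorphism between free monoids is nonerasing if no letter is mapped to the empty word $\varepsilon$. A word $U$ is an instance of a word $V$ (a $V$-instance) if $U=\phi(V)$ for some nonerasing homomorphism $\phi$. A word $W$ encounters $V$ if some factor of $W$ is a $V$-instance. The Zimin words are defined by $Z_0=\varepsilon$ and $Z_{n+1}=Z_n x_n Z_n$, where $x_0,x_1,x_2,\dots$ are distinct letters (so $Z_1=a$, $Z_2=aba$, $Z_3=abacaba$, and so on). $f(n,q)$ is the least integer $M$ such that every $q$-ary word of length $M$ encounters $Z_n$.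
   Formalization: The inequality is proved for all n≥1, q≥2, but the equality with q^{2^{n-1}(1+o(1))} only as n→∞ (uniformly in q≥2); as q→∞ with n fixed it is false, e.g. for n=1 the bound is the constant √2−1. *)

theory Defs
  imports Complex_Main "HOL-Library.Sublist" "HOL-Library.Landau_Symbols"
begin

text \<open>
  Words are lists, the free monoid on a letter type; a factor of a word is a (contiguous)
  \<^const>\<open>sublist\<close>.
\<close>

definition q_ary :: "nat \<Rightarrow> 'a list \<Rightarrow> bool" where
  "q_ary q w \<longleftrightarrow> card (set w) \<le> q"

definition word_hom :: "('a list \<Rightarrow> 'b list) \<Rightarrow> bool" where
  "word_hom \<phi> \<longleftrightarrow> \<phi> [] = [] \<and> (\<forall>u v. \<phi> (u @ v) = \<phi> u @ \<phi> v)"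

definition nonerasing :: "('a list \<Rightarrow> 'b list) \<Rightarrow> bool" where
  "nonerasing \<phi> \<longleftrightarrow> (\<forall>x. \<phi> [x] \<noteq> [])"

definition instance_of :: "'b list \<Rightarrow> 'a list \<Rightarrow> bool" where
  "instance_of u v \<longleftrightarrow> (\<exists>\<phi>. word_hom \<phi> \<and> nonerasing \<phi> \<and> u = \<phi> v)"

definition encounters :: "'b list \<Rightarrow> 'a list \<Rightarrow> bool" where
  "encounters w v \<longleftrightarrow> (\<exists>u. sublist u w \<and> instance_of u v)"

text \<open>The letter $x_n$ is the natural number $n$.\<close>

primrec zimin :: "nat \<Rightarrow> nat list" where
  "zimin 0 = []"
| "zimin (Suc n) = zimin n @ [n] @ zimin n"

text \<open>
  Whether a word encounters \<^term>\<open>zimin n\<close> is invariant under renaming its letters injectively,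
  so quantifying over words with letters in \<^typ>\<open>nat\<close> covers words over every alphabet.
\<close>

definition zimin_f :: "nat \<Rightarrow> nat \<Rightarrow> nat" where
  "zimin_f n q = (LEAST M. \<forall>w :: nat list. q_ary q w \<and> length w = M \<longrightarrow> encounters w (zimin n))"

text \<open>
  The explicit lower bound
  $\sqrt{2q^{2^n} / (q^{n+1} e^{(n-1)/(q-1)})} - 1$, with real (not truncated) subtraction.
\<close>

definition zimin_lower :: "nat \<Rightarrow> nat \<Rightarrow> real" where
  "zimin_lower n q =
     sqrt (2 * real q ^ (2 ^ n) / (real q ^ (n + 1) * exp ((real n - 1) / (real q - 1)))) - 1"

end

theory Submission
  imports Defs
begin

text \<open>
  The lower bound is a first-moment argument. Draw a word of length \<open>M\<close> uniformly over
  \<open>q\<close> letters. If each of its \<open>M (M + 1) / 2\<close> nonempty factor positions carries an instance of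
  the Zimin word \<open>Z\<^sub>n\<close> with probability at most \<open>c\<^sub>n\<close>, then some word of length \<open>M\<close> avoids
  \<open>Z\<^sub>n\<close> as soon as \<open>M (M + 1) c\<^sub>n < 2\<close>, in particular as soon as
  \<open>M < sqrt (2 / c\<^sub>n) - 1\<close>.

  The numbers \<open>c\<^sub>n\<close> come from the recursive shape of the instances: those of \<open>Z\<^sub>n\<^sub>+\<^sub>1\<close> are the
  words \<open>zyz\<close> with \<open>z\<close> an instance of \<open>Z\<^sub>n\<close> and \<open>y\<close> nonempty
  (\<open>instance_of_zimin_Suc\<close>). If \<open>z\<close> has length \<open>l\<close>, then \<open>z\<close> is an instance with
  probability at most \<open>c\<^sub>n\<close>, and the second copy matches the first with probability
  \<open>q\<^sup>-\<^sup>l\<close>. As \<open>l \<ge> 2\<^sup>n - 1\<close>, the geometric series over \<open>l\<close> gives a factor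
  \<open>(q / q ^ 2\<^sup>n) (1 + 1 / (q - 1))\<close>, whose last part is at most \<open>exp (1 / (q - 1))\<close>. Starting from
  \<open>c\<^sub>1 = 1\<close>, these factors multiply up to \<open>q\<^sup>n\<^sup>+\<^sup>1 exp ((n - 1) / (q - 1)) / q ^ 2\<^sup>n\<close>, so that
  \<open>sqrt (2 / c\<^sub>n) - 1\<close> is the stated bound (\<open>card_zimin_instances_le\<close>,
  \<open>card_encountering_words_le\<close>).

  A least element of a set of lengths says something about words only if the set is nonempty, so
  the argument also needs that Zimin words are unavoidable over every finite alphabet; this follows
  from the pigeonhole principle (\<open>zimin_unavoidable\<close>).

  For the asymptotics, the base-\<open>q\<close> logarithm of the bound differs from \<open>2\<^sup>n\<^sup>-\<^sup>1\<close> by at most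
  \<open>(3 n + 1) / 2\<close> for \<open>n \<ge> 4\<close>, whatever \<open>q \<ge> 2\<close> is, because \<open>exp (1 / (q - 1)) \<le> q\<^sup>2\<close>. Hence the
  relative error of the exponent tends to 0 as \<open>n\<close> grows, uniformly in \<open>q\<close>
  (\<open>abs_exponent_error_le\<close>).
\<close>

section \<open>Instances of Zimin words\<close>

lemma set_zimin: "set (zimin n) = {..<n}"
  by (induction n) (simp_all add: lessThan_Suc)

lemma word_hom_conv_concat:
  assumes "word_hom \<phi>"
  shows "\<phi> w = concat (map (\<lambda>i. \<phi> [i]) w)"
proof (induction w)
  case Nil
  then show ?case using assms by (simp add: word_hom_def)
next
  case (Cons a w)
  have "\<phi> ([a] @ w) = \<phi> [a] @ \<phi> w" using assms unfolding word_hom_def by blast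
  then show ?case using Cons by simp
qed

text \<open>
  The letter \<open>n\<close> does not occur in \<^term>\<open>zimin n\<close>, so its image can be chosen freely without
  disturbing the image of \<^term>\<open>zimin n\<close>.
\<close>

lemma instance_of_zimin_Suc:
  "instance_of u (zimin (Suc n)) \<longleftrightarrow>
     (\<exists>z y. instance_of z (zimin n) \<and> y \<noteq> [] \<and> u = z @ y @ z)"
proof
  assume "instance_of u (zimin (Suc n))"
  then obtain \<phi> where \<phi>: "word_hom \<phi>" "nonerasing \<phi>" "u = \<phi> (zimin (Suc n))"
    unfolding instance_of_def by blast
  then have "u = \<phi> (zimin n) @ \<phi> [n] @ \<phi> (zimin n)"
    unfolding word_hom_def zimin.simps by metis
  moreover have "\<phi> [n] \<noteq> []" using \<phi>(2) unfolding nonerasing_def by blast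
  ultimately show "\<exists>z y. instance_of z (zimin n) \<and> y \<noteq> [] \<and> u = z @ y @ z"
    using \<phi>(1,2) unfolding instance_of_def by blast
next
  assume "\<exists>z y. instance_of z (zimin n) \<and> y \<noteq> [] \<and> u = z @ y @ z"
  then obtain \<phi> y where \<phi>: "word_hom \<phi>" "nonerasing \<phi>" "y \<noteq> []"
    "u = \<phi> (zimin n) @ y @ \<phi> (zimin n)"
    unfolding instance_of_def by blast
  define \<psi> where "\<psi> w = concat (map (\<lambda>i. if i = n then y else \<phi> [i]) w)" for w
  have "map (\<lambda>i. if i = n then y else \<phi> [i]) (zimin n) = map (\<lambda>i. \<phi> [i]) (zimin n)"
    using set_zimin[of n] by (intro map_cong) auto
  then have eq: "\<psi> (zimin n) = \<phi> (zimin n)"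
    unfolding \<psi>_def word_hom_conv_concat[OF \<phi>(1), of "zimin n"] by (simp only:)
  have "word_hom \<psi>" by (simp add: word_hom_def \<psi>_def)
  moreover have "nonerasing \<psi>" using \<phi>(2,3) by (simp add: nonerasing_def \<psi>_def)
  moreover have "\<psi> (zimin (Suc n)) = \<psi> (zimin n) @ y @ \<psi> (zimin n)"
    by (simp add: \<psi>_def)
  then have "u = \<psi> (zimin (Suc n))" using \<phi>(4) eq by simp
  ultimately show "instance_of u (zimin (Suc n))" unfolding instance_of_def by blast
qed

lemma length_instance_of_zimin:
  "instance_of u (zimin n) \<Longrightarrow> 2 ^ n - 1 \<le> length u"
proof (induction n arbitrary: u)
  case (Suc n)
  then obtain z y where zy: "instance_of z (zimin n)" "y \<noteq> []" "u = z @ y @ z"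
    unfolding instance_of_zimin_Suc by blast
  then have "2 ^ n - 1 \<le> length z" "1 \<le> length y"
    using Suc.IH by (auto simp: Suc_le_eq)
  then show ?case using zy(3) by simp
qed simp

section \<open>Unavoidability\<close>

text \<open>
  Let every \<open>q\<close>-ary word of length \<open>M\<close> encounter \<^term>\<open>zimin n\<close>, and cut a long word into
  blocks of length \<open>M\<close> separated by single letters. Among more than \<open>q\<^sup>M\<close> blocks two coincide, and
  the instance of \<^term>\<open>zimin n\<close> inside them occurs twice; the separating letters make the
  word between the two occurrences nonempty.
\<close>

lemma zimin_unavoidable:
  "\<exists>M. \<forall>w :: 'a list. q_ary q w \<and> length w = M \<longrightarrow> encounters w (zimin n)"
proof (induction n)
  case 0
  have "instance_of ([] :: 'a list) (zimin 0)"
    unfolding instance_of_def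
    by (rule exI[of _ "map (\<lambda>_. undefined)"]) (auto simp: word_hom_def nonerasing_def)
  then have "encounters w (zimin 0)" for w :: "'a list"
    unfolding encounters_def by (intro exI[of _ "[]"]) simp
  then show ?case by blast
next
  case (Suc n)
  then obtain M where
    M: "\<And>w :: 'a list. q_ary q w \<Longrightarrow> length w = M \<Longrightarrow> encounters w (zimin n)" by blast
  define N where "N = Suc (q ^ M) * Suc M"
  have "encounters w (zimin (Suc n))" if w: "q_ary q w" "length w = N" for w :: "'a list"
  proof -
    define block where "block i = take M (drop (i * Suc M) w)" for i
    have fits: "i * Suc M + Suc M \<le> length w" if "i \<le> q ^ M" for i
    proof -
      have "Suc i * Suc M \<le> Suc (q ^ M) * Suc M" using that by (intro mult_right_mono) auto
      then show ?thesis using w N_def by simp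
    qed
    have len: "length (block i) = M" if "i \<le> q ^ M" for i
      using fits[OF that] by (simp add: block_def)
    have sub: "set (block i) \<subseteq> set w" for i
      unfolding block_def by (meson set_drop_subset set_take_subset subset_trans)
    let ?B = "{u. set u \<subseteq> set w \<and> length u = M}"
    have "card ?B \<le> q ^ M"
      using w(1) by (simp add: card_lists_length_eq q_ary_def power_mono)
    moreover have "finite ?B" by (simp add: finite_lists_length_eq)
    moreover have "block ` {..q ^ M} \<subseteq> ?B" using len sub by auto
    ultimately have "card (block ` {..q ^ M}) \<le> q ^ M" by (meson card_mono le_trans)
    then have "\<not> inj_on block {..q ^ M}" by (intro pigeonhole) simp
    then obtain i j where ij: "i \<le> q ^ M" "j \<le> q ^ M" "i < j" "block i = block j"
      unfolding inj_on_def by (metis atMost_iff linorder_neqE_nat)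
    have "q_ary q (block i)"
      using w(1) card_mono[OF finite_set sub[of i]] by (simp add: q_ary_def)
    then obtain p z s where z: "block i = p @ z @ s" "instance_of z (zimin n)"
      using M len[OF ij(1)] unfolding encounters_def sublist_def by metis
    define gap where "gap = take (j * Suc M - (i * Suc M + M)) (drop (i * Suc M + M) w)"
    have "i * Suc M + Suc M \<le> j * Suc M"
      using ij(3) mult_le_mono1[of "Suc i" j "Suc M"] by simp
    then have "j * Suc M = (i * Suc M + M) + (j * Suc M - (i * Suc M + M))"
      and pos: "0 < j * Suc M - (i * Suc M + M)" by linarith+
    then have "drop (i * Suc M + M) w = gap @ drop (j * Suc M) w"
      unfolding gap_def by (metis append_take_drop_id drop_drop add.commute)
    moreover have "w = take (i * Suc M) w @ block i @ drop (i * Suc M + M) w"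
      unfolding block_def by (metis append_take_drop_id drop_drop add.commute)
    moreover have "drop (j * Suc M) w = block j @ drop (j * Suc M + M) w"
      unfolding block_def by (metis append_take_drop_id drop_drop add.commute)
    ultimately have "w = take (i * Suc M) w @ block i @ gap @ block j @ drop (j * Suc M + M) w"
      by simp
    then have "w = (take (i * Suc M) w @ p) @ (z @ (s @ gap @ p) @ z) @ s @ drop (j * Suc M + M) w"
      using z(1) ij(4) by simp
    then have "sublist (z @ (s @ gap @ p) @ z) w" unfolding sublist_def by blast
    moreover have "gap \<noteq> []" using pos fits[OF ij(2)] by (auto simp: gap_def)
    then have "instance_of (z @ (s @ gap @ p) @ z) (zimin (Suc n))"
      unfolding instance_of_zimin_Suc using z(2) by blast
    ultimately show ?thesis unfolding encounters_def by blast
  qed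
  then show ?case by blast
qed

lemma zimin_f_encounters:
  fixes w :: "nat list"
  assumes "q_ary q w" "length w = zimin_f n q"
  shows "encounters w (zimin n)"
  using LeastI_ex[OF zimin_unavoidable[where 'a=nat, of q n]] assms
  unfolding zimin_f_def by blast

section \<open>Counting instances\<close>

definition words :: "nat \<Rightarrow> nat \<Rightarrow> nat list set" where
  "words q m = {w. set w \<subseteq> {..<q} \<and> length w = m}"

definition zimin_instances :: "nat \<Rightarrow> nat \<Rightarrow> nat \<Rightarrow> nat list set" where
  "zimin_instances n q m = {u \<in> words q m. instance_of u (zimin n)}"

text \<open>
  An upper bound \<open>c\<^sub>n\<close> for the probability that a random word of any fixed length over \<open>q\<close> letters
  is an instance of \<^term>\<open>zimin n\<close>, for \<open>n \<ge> 1\<close>.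
\<close>

definition density_bound :: "nat \<Rightarrow> nat \<Rightarrow> real" where
  "density_bound n q =
     real q ^ (n + 1) * exp ((real n - 1) / (real q - 1)) / real q ^ (2 ^ n)"

lemma finite_words [simp]: "finite (words q m)"
  unfolding words_def by (simp add: finite_lists_length_eq)

lemma card_words: "card (words q m) = q ^ m"
  unfolding words_def by (simp add: card_lists_length_eq)

lemma finite_zimin_instances [simp]: "finite (zimin_instances n q m)"
  unfolding zimin_instances_def by simp

lemma density_bound_nonneg: "0 \<le> density_bound n q"
  by (simp add: density_bound_def)

text \<open>
  The geometric tail equals \<open>q / q ^ 2\<^sup>n * (1 + 1 / (q - 1))\<close>, and replacing the last factor by
  \<open>exp (1 / (q - 1))\<close> is what turns the product over all \<open>n\<close> into a closed form.
\<close>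

lemma density_bound_Suc:
  assumes "2 \<le> q"
  shows "density_bound n q * ((1 / real q) ^ (2 ^ n - 1) / (1 - 1 / real q))
           \<le> density_bound (Suc n) q"
proof -
  have q: "real q > 1" using assms by simp
  have "(1 / real q) ^ (2 ^ n - 1) / (1 - 1 / real q)
          = real q / real q ^ (2 ^ n) * (1 + 1 / (real q - 1))"
    using q by (simp add: power_diff field_simps)
  also have "\<dots> \<le> real q / real q ^ (2 ^ n) * exp (1 / (real q - 1))"
    by (intro mult_left_mono exp_ge_add_one_self) auto
  finally have "density_bound n q * ((1 / real q) ^ (2 ^ n - 1) / (1 - 1 / real q))
      \<le> density_bound n q * (real q / real q ^ (2 ^ n) * exp (1 / (real q - 1)))"
    by (rule mult_left_mono) (rule density_bound_nonneg)
  also have "\<dots> = density_bound (Suc n) q"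
  proof -
    have "(real (Suc n) - 1) / (real q - 1) = (real n - 1) / (real q - 1) + 1 / (real q - 1)"
      by (simp add: add_divide_distrib [symmetric])
    then have "exp ((real (Suc n) - 1) / (real q - 1))
        = exp ((real n - 1) / (real q - 1)) * exp (1 / (real q - 1))"
      by (simp only: exp_add)
    moreover have "real q ^ 2 ^ Suc n = real q ^ 2 ^ n * real q ^ 2 ^ n"
      by (simp add: power_add [symmetric] mult_2)
    ultimately show ?thesis unfolding density_bound_def by simp
  qed
  finally show ?thesis .
qed

lemma geometric_segment_le:
  fixes x :: real
  assumes "0 \<le> x" "x < 1" "finite L" "\<And>l. l \<in> L \<Longrightarrow> a \<le> l"
  shows "(\<Sum>l\<in>L. x ^ l) \<le> x ^ a / (1 - x)"
proof -
  have sm: "summable (\<lambda>k. x ^ a * x ^ k)"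
    using assms by (intro summable_mult summable_geometric) auto
  have "(\<Sum>l\<in>L. x ^ l) = (\<Sum>k\<in>(\<lambda>l. l - a) ` L. x ^ a * x ^ k)"
    using assms(4)
    by (subst sum.reindex) (auto simp: inj_on_def eq_diff_iff power_add [symmetric] intro!: sum.cong)
  also have "\<dots> \<le> (\<Sum>k. x ^ a * x ^ k)"
    using assms sm by (intro sum_le_suminf) auto
  also have "\<dots> = x ^ a / (1 - x)"
    using assms by (subst suminf_mult) (auto simp: suminf_geometric)
  finally show ?thesis .
qed

text \<open>
  In an instance \<open>zyz\<close> of length \<open>m\<close>, the first \<open>z\<close> of length \<open>l\<close> can be chosen in at most
  \<open>q\<^sup>l c\<^sub>n\<close> ways, \<open>y\<close> in \<open>q ^ (m - 2 l)\<close> ways, and the second \<open>z\<close> is then determined. This leaves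
  \<open>q\<^sup>m c\<^sub>n\<close> times the sum of \<open>q\<^sup>-\<^sup>l\<close> over the admissible lengths. The induction starts at
  \<open>n = 1\<close>, where every nonempty word is an instance and \<open>c\<^sub>1 = 1\<close>.
\<close>

lemma card_zimin_instances_le:
  assumes q: "2 \<le> q"
  shows "1 \<le> n \<Longrightarrow> real (card (zimin_instances n q m)) \<le> real q ^ m * density_bound n q"
proof (induction n arbitrary: m rule: dec_induct)
  case base
  have "card (zimin_instances 1 q m) \<le> card (words q m)"
    unfolding zimin_instances_def by (intro card_mono) auto
  then have "real (card (zimin_instances 1 q m)) \<le> real (q ^ m)"
    unfolding card_words using of_nat_le_iff by blast
  moreover have "density_bound 1 q = 1"
    using q by (simp add: density_bound_def power2_eq_square)
  ultimately show ?case by simp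
next
  case (step n)
  define L where "L = {l. 2 ^ n - 1 \<le> l \<and> 2 * l < m}"
  have fin: "finite L" by (rule finite_subset[of _ "{..m}"]) (auto simp: L_def)
  let ?join = "\<lambda>(z, y). z @ y @ z"
  let ?P = "\<lambda>l. zimin_instances n q l \<times> words q (m - 2 * l)"
  have "zimin_instances (Suc n) q m \<subseteq> (\<Union>l\<in>L. ?join ` ?P l)"
  proof
    fix u assume "u \<in> zimin_instances (Suc n) q m"
    then obtain z y where u: "set u \<subseteq> {..<q}" "length u = m" "instance_of z (zimin n)"
      "y \<noteq> []" "u = z @ y @ z"
      unfolding zimin_instances_def words_def instance_of_zimin_Suc by blast
    have "length z \<in> L" using u length_instance_of_zimin[OF u(3)] by (auto simp: L_def)
    moreover have "(z, y) \<in> ?P (length z)"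
      using u by (auto simp: zimin_instances_def words_def)
    ultimately show "u \<in> (\<Union>l\<in>L. ?join ` ?P l)" using u(5) by force
  qed
  then have "card (zimin_instances (Suc n) q m) \<le> card (\<Union>l\<in>L. ?join ` ?P l)"
    using fin by (intro card_mono finite_UN_I finite_imageI finite_cartesian_product) auto
  also have "\<dots> \<le> (\<Sum>l\<in>L. card (?join ` ?P l))" by (rule card_UN_le[OF fin])
  also have "\<dots> \<le> (\<Sum>l\<in>L. card (?P l))" by (intro sum_mono card_image_le) auto
  also have "\<dots> = (\<Sum>l\<in>L. card (zimin_instances n q l) * q ^ (m - 2 * l))"
    by (simp add: card_words card_cartesian_product)
  finally have "real (card (zimin_instances (Suc n) q m))
      \<le> real (\<Sum>l\<in>L. card (zimin_instances n q l) * q ^ (m - 2 * l))"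
    using of_nat_le_iff by blast
  also have "\<dots> = (\<Sum>l\<in>L. real (card (zimin_instances n q l)) * real q ^ (m - 2 * l))"
    by simp
  also have "\<dots> \<le> (\<Sum>l\<in>L. (real q ^ l * density_bound n q) * real q ^ (m - 2 * l))"
    by (intro sum_mono mult_right_mono step.IH) auto
  also have "\<dots> = (\<Sum>l\<in>L. (real q ^ m * density_bound n q) * (1 / real q) ^ l)"
  proof (rule sum.cong)
    fix l assume "l \<in> L"
    then have "m = (l + (m - 2 * l)) + l" by (auto simp: L_def)
    then have "real q ^ m = real q ^ l * real q ^ (m - 2 * l) * real q ^ l"
      by (metis power_add)
    then show "(real q ^ l * density_bound n q) * real q ^ (m - 2 * l)
        = (real q ^ m * density_bound n q) * (1 / real q) ^ l"
      using q by (simp add: power_one_over)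
  qed simp
  also have "\<dots> = real q ^ m * density_bound n q * (\<Sum>l\<in>L. (1 / real q) ^ l)"
    by (simp add: sum_distrib_left)
  also have "\<dots> \<le> real q ^ m * density_bound n q * ((1 / real q) ^ (2 ^ n - 1) / (1 - 1 / real q))"
    using q fin density_bound_nonneg
    by (intro mult_left_mono geometric_segment_le) (auto simp: L_def)
  also have "\<dots> \<le> real q ^ m * density_bound (Suc n) q"
    using mult_left_mono[OF density_bound_Suc[OF q, of n], of "real q ^ m"]
    by (simp add: mult.assoc)
  finally show ?case .
qed

text \<open>
  A union bound over the start \<open>i\<close> and the length \<open>l \<ge> 1\<close> of the instance: the letters outside it
  are free, so each of the \<open>M (M + 1) / 2\<close> pairs contributes at most \<open>q\<^sup>M c\<^sub>n\<close> words.
\<close>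

lemma card_encountering_words_le:
  assumes q: "2 \<le> q" and n: "1 \<le> n"
  shows "real (card {w \<in> words q M. encounters w (zimin n)})
           \<le> real (M * (M + 1)) / 2 * (real q ^ M * density_bound n q)"
proof -
  define I where "I = (SIGMA i:{..<M}. {1..M - i})"
  let ?join = "\<lambda>(p, u, s). p @ u @ s"
  let ?P = "\<lambda>(i, l). words q i \<times> zimin_instances n q l \<times> words q (M - i - l)"
  have fin: "finite I" by (simp add: I_def)
  have "{w \<in> words q M. encounters w (zimin n)} \<subseteq> (\<Union>x\<in>I. ?join ` ?P x)"
  proof
    fix w assume "w \<in> {w \<in> words q M. encounters w (zimin n)}"
    then obtain p u s where w: "set w \<subseteq> {..<q}" "length w = M" "w = p @ u @ s"
      "instance_of u (zimin n)"
      unfolding words_def encounters_def sublist_def by blast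
    have "(2::nat) ^ 1 \<le> 2 ^ n" using n by (intro power_increasing) auto
    then have "1 \<le> length u" using length_instance_of_zimin[OF w(4)] by simp
    then have "(length p, length u) \<in> I" using w(2,3) by (auto simp: I_def)
    moreover have "(p, u, s) \<in> ?P (length p, length u)"
      using w by (auto simp: words_def zimin_instances_def)
    ultimately show "w \<in> (\<Union>x\<in>I. ?join ` ?P x)" using w(3) by force
  qed
  then have "card {w \<in> words q M. encounters w (zimin n)} \<le> card (\<Union>x\<in>I. ?join ` ?P x)"
    using fin by (intro card_mono finite_UN_I finite_imageI) (auto split: prod.splits)
  also have "\<dots> \<le> (\<Sum>x\<in>I. card (?join ` ?P x))" by (rule card_UN_le[OF fin])
  also have "\<dots> \<le> (\<Sum>x\<in>I. card (?P x))"
    by (intro sum_mono card_image_le) (auto split: prod.splits)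
  finally have "real (card {w \<in> words q M. encounters w (zimin n)})
      \<le> real (\<Sum>x\<in>I. card (?P x))"
    using of_nat_le_iff by blast
  also have "\<dots> = (\<Sum>x\<in>I. real (card (?P x)))" by simp
  also have "\<dots> \<le> (\<Sum>x\<in>I. real q ^ M * density_bound n q)"
  proof (rule sum_mono)
    fix x assume "x \<in> I"
    then obtain i l where x: "x = (i, l)" and il: "i + l \<le> M" by (auto simp: I_def)
    have "real (card (?P x))
        = real q ^ i * real q ^ (M - i - l) * real (card (zimin_instances n q l))"
      by (simp add: x card_cartesian_product card_words)
    also have "\<dots> \<le> real q ^ i * real q ^ (M - i - l) * (real q ^ l * density_bound n q)"
      by (intro mult_left_mono card_zimin_instances_le[OF q n]) auto
    also have "\<dots> = real q ^ M * density_bound n q"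
    proof -
      have "M = i + (M - i - l) + l" using il by simp
      then have "real q ^ M = real q ^ i * real q ^ (M - i - l) * real q ^ l"
        by (metis power_add)
      then show ?thesis by simp
    qed
    finally show "real (card (?P x)) \<le> real q ^ M * density_bound n q" .
  qed
  also have "\<dots> = real (card I) * (real q ^ M * density_bound n q)" by simp
  also have "real (card I) = real (M * (M + 1)) / 2"
  proof -
    have "card I = (\<Sum>i<M. M - i)" by (simp add: I_def)
    also have "\<dots> = (\<Sum>i<M. Suc i)"
      by (subst sum.nat_diff_reindex[symmetric]) (auto intro!: sum.cong)
    also have "2 * \<dots> = M * (M + 1)" by (induction M) auto
    finally have "2 * card I = M * (M + 1)" by simp
    then have "real (2 * card I) = real (M * (M + 1))" by simp
    then show ?thesis by simp
  qed
  finally show ?thesis .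
qed

lemma zimin_lower_conv_density_bound: "zimin_lower n q = sqrt (2 / density_bound n q) - 1"
  by (simp add: zimin_lower_def density_bound_def)

text \<open>
  Were the length \<open>M = f(n,q)\<close> below the bound, the words of length \<open>M\<close> that encounter
  \<^term>\<open>zimin n\<close> would be fewer than all \<open>q\<^sup>M\<close> words, leaving one that avoids it.
\<close>

lemma zimin_f_ge_zimin_lower:
  assumes q: "2 \<le> q" and n: "1 \<le> n"
  shows "zimin_lower n q \<le> real (zimin_f n q)"
proof (rule ccontr)
  define M where "M = zimin_f n q"
  define c where "c = density_bound n q"
  have c: "0 < c" using q by (simp add: c_def density_bound_def)
  assume "\<not> zimin_lower n q \<le> real (zimin_f n q)"
  then have "real M + 1 < sqrt (2 / c)"
    by (simp add: zimin_lower_conv_density_bound M_def c_def)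
  then have "(real M + 1) ^ 2 < (sqrt (2 / c)) ^ 2"
    by (intro power_strict_mono) auto
  then have "(real M + 1) ^ 2 < 2 / c" using c by simp
  moreover have "real (M * (M + 1)) \<le> (real M + 1) ^ 2"
    by (simp add: power2_eq_square algebra_simps)
  ultimately have "real (M * (M + 1)) < 2 / c" by linarith
  then have "real (M * (M + 1)) / 2 * c < 1" using c by (simp add: field_simps)
  then have "real q ^ M * (real (M * (M + 1)) / 2 * c) < real q ^ M * 1"
    using q by (intro mult_strict_left_mono) auto
  moreover have "real (card {w \<in> words q M. encounters w (zimin n)})
      \<le> real q ^ M * (real (M * (M + 1)) / 2 * c)"
    using card_encountering_words_le[OF q n, of M] by (simp only: c_def mult_ac)
  ultimately have "real (card {w \<in> words q M. encounters w (zimin n)}) < real q ^ M * 1"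
    by (rule le_less_trans[rotated])
  then have "real (card {w \<in> words q M. encounters w (zimin n)}) < real (card (words q M))"
    by (simp only: card_words of_nat_power mult_1_right)
  then have "{w \<in> words q M. encounters w (zimin n)} \<noteq> words q M" by force
  then obtain w where w: "w \<in> words q M" "\<not> encounters w (zimin n)" by blast
  have "card (set w) \<le> card {..<q}" using w(1) by (intro card_mono) (auto simp: words_def)
  then have "q_ary q w" by (simp add: q_ary_def)
  then show False using zimin_f_encounters w by (auto simp: words_def M_def)
qed

section \<open>Growth of the bound\<close>

text \<open>
  The exponential factor is only \<open>q\<close> to a power linear in \<open>n\<close>, negligible against the
  exponent \<open>2\<^sup>n\<close>; here \<open>e \<le> 4 \<le> q\<^sup>2\<close> is used.
\<close>

lemma exp_le_square_power:
  assumes q: "2 \<le> q" and n: "1 \<le> n"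
  shows "exp ((real n - 1) / (real q - 1)) \<le> real q ^ (2 * (n - 1))"
proof -
  have "(real n - 1) / (real q - 1) \<le> (real n - 1) / 1"
    using q n by (intro divide_left_mono) auto
  then have "exp ((real n - 1) / (real q - 1)) \<le> exp (real (n - 1) * 1)"
    using n by simp
  also have "\<dots> = exp 1 ^ (n - 1)" by (simp only: exp_of_nat_mult)
  also have "\<dots> \<le> (real q ^ 2) ^ (n - 1)"
  proof (rule power_mono)
    have "exp 1 \<le> (2::real) ^ 2" using exp_le by simp
    also have "\<dots> \<le> real q ^ 2" using q by (intro power_mono) auto
    finally show "exp 1 \<le> real q ^ 2" .
  qed simp
  finally show ?thesis by (simp add: power_mult)
qed

lemma density_bound_le:
  assumes q: "2 \<le> q" and n: "1 \<le> n"
  shows "density_bound n q \<le> real q ^ (3 * n - 1) / real q ^ (2 ^ n)"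
proof -
  have "n + 1 + 2 * (n - 1) = 3 * n - 1" using n by simp
  then have "real q ^ (3 * n - 1) = real q ^ (n + 1) * real q ^ (2 * (n - 1))"
    by (metis power_add)
  then show ?thesis unfolding density_bound_def
    using exp_le_square_power[OF q n] q
    by (auto intro!: divide_right_mono mult_left_mono)
qed

lemma linear_le_two_power: "4 \<le> n \<Longrightarrow> 3 * n + 1 \<le> (2::nat) ^ n"
  by (induction n rule: dec_induct) auto

text \<open>
  Only a positive number is a power of \<open>q\<close>, so the bound has to exceed 0 for every single \<open>n\<close>,
  not just for large ones. The crude estimate of \<open>c\<^sub>n\<close> suffices where
  \<open>3 n - 1 \<le> 2\<^sup>n\<close>, that is, everywhere except at \<open>n = 2\<close>, where
  \<open>c\<^sub>2 = exp (1 / (q - 1)) / q\<close> is estimated directly.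
\<close>

lemma zimin_lower_pos:
  assumes q: "2 \<le> q" and n: "1 \<le> n"
  shows "0 < zimin_lower n q"
proof -
  have qr: "2 \<le> real q" using q by simp
  have c: "0 < density_bound n q" using q by (simp add: density_bound_def)
  (* The root of 2 / c exceeds 1 exactly when c < 2. *)
  have "density_bound n q < 2"
  proof (cases "n = 2")
    case True
    have "exp (1 / (real q - 1)) \<le> exp 1" using qr by simp
    also have "\<dots> \<le> (3::real)" by (rule exp_le)
    also have "\<dots> < 2 * real q" using qr by simp
    finally have "exp (1 / (real q - 1)) < 2 * real q" .
    then show ?thesis using qr True
      by (simp add: density_bound_def field_simps power_numeral_reduce eval_nat_numeral)
  next
    case False
    have "3 * n - 1 \<le> (2::nat) ^ n"
    proof (cases "4 \<le> n")
      case True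
      then show ?thesis using linear_le_two_power[of n] by simp
    next
      case False
      with \<open>n \<noteq> 2\<close> n have "n = 1 \<or> n = 3" by arith
      then show ?thesis by auto
    qed
    then have "real q ^ (3 * n - 1) \<le> real q ^ (2 ^ n)"
      using qr by (intro power_increasing) auto
    then have "real q ^ (3 * n - 1) / real q ^ (2 ^ n) \<le> 1" using qr by simp
    then show ?thesis using density_bound_le[OF q n] by linarith
  qed
  then have "1 < 2 / density_bound n q" using c by simp
  then show ?thesis by (simp add: zimin_lower_conv_density_bound)
qed

lemma zimin_lower_le:
  assumes q: "2 \<le> q" and n: "1 \<le> n"
  shows "zimin_lower n q \<le> real q powr (2 ^ (n - 1))"
proof -
  have qr: "2 \<le> real q" using q by simp
  define e where "e = exp ((real n - 1) / (real q - 1))"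
  have "2 * 1 \<le> real q ^ (n + 1) * e"
  proof (rule mult_mono)
    show "2 \<le> real q ^ (n + 1)"
      using qr self_le_power[of "real q" "n + 1"] by linarith
    have "0 \<le> (real n - 1) / (real q - 1)" using n qr by simp
    then show "1 \<le> e" by (simp add: e_def)
  qed auto
  moreover have "0 < real q ^ (n + 1) * e" using qr by (simp add: e_def)
  moreover have "2 * 1 * real q ^ (2 ^ n) \<le> real q ^ (n + 1) * e * real q ^ (2 ^ n)"
    using calculation(1) by (rule mult_right_mono) simp
  ultimately have "2 * real q ^ (2 ^ n) / (real q ^ (n + 1) * e) \<le> real q ^ (2 ^ n)"
    by (simp add: pos_divide_le_eq mult_ac)
  also have "\<dots> = (real q ^ (2 ^ (n - 1))) ^ 2"
    using n by (simp add: power_mult [symmetric] power_Suc2 [symmetric] del: power_Suc)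
  finally have "sqrt (2 * real q ^ (2 ^ n) / (real q ^ (n + 1) * e)) \<le> real q ^ (2 ^ (n - 1))"
    by (intro real_le_lsqrt) auto
  then have "zimin_lower n q \<le> real q ^ (2 ^ (n - 1))"
    by (simp add: zimin_lower_def e_def)
  also have "\<dots> = real q powr (2 ^ (n - 1))"
    using qr powr_realpow[of "real q" "2 ^ (n - 1)"] by simp
  finally show ?thesis .
qed

text \<open>
  Weakening the exponent \<open>2\<^sup>n - (3 n - 1)\<close> from the estimate of \<open>c\<^sub>n\<close> by 2 leaves a factor
  \<open>q\<^sup>2 \<ge> 4\<close> under the root, which pays for the subtracted 1.
\<close>

lemma zimin_lower_ge:
  assumes q: "2 \<le> q" and n: "4 \<le> n"
  shows "real q powr ((2 ^ n - (3 * real n + 1)) / 2) \<le> zimin_lower n q"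
proof -
  have qr: "2 \<le> real q" using q by simp
  define Y where "Y = real q ^ (2 ^ n - (3 * n + 1))"
  have c: "0 < density_bound n q" using q by (simp add: density_bound_def)
  have Y1: "1 \<le> Y" using qr by (simp add: Y_def)
  (* By n >= 4 the truncated subtraction in the exponent of Y is a true one. *)
  have "2 ^ n = 2 + (2 ^ n - (3 * n + 1)) + (3 * n - 1)"
    using linear_le_two_power[OF n] n by simp
  then have "real q ^ (2 ^ n) = real q ^ 2 * Y * real q ^ (3 * n - 1)"
    unfolding Y_def by (metis power_add)
  then have "density_bound n q \<le> 1 / (real q ^ 2 * Y)"
    using density_bound_le[OF q, of n] n qr by simp
  then have "2 / (1 / (real q ^ 2 * Y)) \<le> 2 / density_bound n q"
    using c qr Y1 by (intro divide_left_mono mult_pos_pos divide_pos_pos) auto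
  then have "2 * (real q ^ 2 * Y) \<le> 2 / density_bound n q" by simp
  moreover have "2 ^ 2 * Y \<le> 2 * (real q ^ 2 * Y)"
  proof -
    have "2 ^ 2 \<le> real q ^ 2" using qr by (intro power_mono) auto
    then have "2 ^ 2 * Y \<le> real q ^ 2 * Y" using Y1 by (intro mult_right_mono) auto
    then show ?thesis using Y1 by simp
  qed
  moreover have "(2 * sqrt Y) ^ 2 = 2 ^ 2 * Y" using Y1 by (simp add: power_mult_distrib)
  ultimately have "(2 * sqrt Y) ^ 2 \<le> 2 / density_bound n q" by linarith
  then have "2 * sqrt Y \<le> sqrt (2 / density_bound n q)" by (rule real_le_rsqrt)
  moreover have "1 \<le> sqrt Y" using Y1 by simp
  ultimately have "sqrt Y \<le> zimin_lower n q"
    unfolding zimin_lower_conv_density_bound by linarith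
  moreover have "sqrt Y = real q powr ((2 ^ n - (3 * real n + 1)) / 2)"
  proof -
    have "Y = real q powr real (2 ^ n - (3 * n + 1))"
      unfolding Y_def using qr by (subst powr_realpow) auto
    also have "real (2 ^ n - (3 * n + 1)) = 2 ^ n - (3 * real n + 1)"
      using linear_le_two_power[OF n] by (subst of_nat_diff) auto
    finally show ?thesis using Y1 by (simp add: powr_half_sqrt[symmetric] powr_powr)
  qed
  ultimately show ?thesis by simp
qed

definition exponent_error :: "nat \<Rightarrow> nat \<Rightarrow> real" where
  "exponent_error n q = log (real q) (zimin_lower n q) / 2 ^ (n - 1) - 1"

lemma zimin_lower_eq_powr:
  assumes q: "2 \<le> q" and n: "1 \<le> n"
  shows "zimin_lower n q = real q powr (2 ^ (n - 1) * (1 + exponent_error n q))"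
  using zimin_lower_pos[OF q n] q by (simp add: exponent_error_def)

lemma abs_exponent_error_le:
  assumes q: "2 \<le> q" and n: "4 \<le> n"
  shows "\<bar>exponent_error n q\<bar> \<le> (3 * real n + 1) / 2 ^ n"
proof -
  have qr: "1 < real q" using q by simp
  have n1: "1 \<le> n" using n by simp
  have pos: "0 < zimin_lower n q" by (rule zimin_lower_pos[OF q n1])
  let ?x = "log (real q) (zimin_lower n q)"
  have "?x \<le> 2 ^ (n - 1)"
    using zimin_lower_le[OF q n1] qr pos by (simp add: log_le_iff)
  moreover have "(2 ^ n - (3 * real n + 1)) / 2 \<le> ?x"
    using zimin_lower_ge[OF q n] by (subst le_log_iff[OF qr pos])
  moreover have n2: "(2::real) ^ n = 2 * 2 ^ (n - 1)"
    using n1 by (simp add: power_Suc [symmetric] del: power_Suc)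
  ultimately have "\<bar>?x - 2 ^ (n - 1)\<bar> \<le> (3 * real n + 1) / 2"
    by (simp only: abs_le_iff) argo
  then have "\<bar>?x - 2 ^ (n - 1)\<bar> / 2 ^ (n - 1) \<le> (3 * real n + 1) / 2 / 2 ^ (n - 1)"
    by (rule divide_right_mono) simp
  moreover have "exponent_error n q = (?x - 2 ^ (n - 1)) / 2 ^ (n - 1)"
    by (simp add: exponent_error_def diff_divide_distrib)
  then have "\<bar>exponent_error n q\<bar> = \<bar>?x - 2 ^ (n - 1)\<bar> / 2 ^ (n - 1)"
    by simp
  ultimately show ?thesis using n2 by simp
qed

text \<open>
  The bound on the error is independent of \<open>q\<close>; this gives convergence along
  \<open>n \<longrightarrow> \<infinity>\<close> uniformly in \<open>q \<ge> 2\<close>, which is what the product with the principal filter means.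
\<close>

lemma exponent_error_smallo:
  "(\<lambda>(n, q). exponent_error n q) \<in> o[sequentially \<times>\<^sub>F principal {2..}](\<lambda>_. 1)"
proof -
  let ?F = "sequentially \<times>\<^sub>F principal {2::nat..}"
  have "(\<lambda>n. (3 * real n + 1) / 2 ^ n) \<longlonglongrightarrow> 0"
  proof -
    have "(\<lambda>n. 3 * (real n / 2 ^ n) + (1 / 2) ^ n) \<longlonglongrightarrow> 3 * 0 + 0"
      by (intro tendsto_intros lim_n_over_pown LIMSEQ_power_zero) auto
    then show ?thesis by (simp add: add_divide_distrib power_one_over)
  qed
  then have lim: "((\<lambda>x. (3 * real (fst x) + 1) / 2 ^ fst x) \<longlongrightarrow> 0) ?F"
    by (rule filterlim_compose) (auto simp: filterlim_def filtermap_fst_prod_filter)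
  have "eventually (\<lambda>x. norm (case x of (n, q) \<Rightarrow> exponent_error n q)
      \<le> norm ((3 * real (fst x) + 1) / 2 ^ fst x) * 1) ?F"
    unfolding eventually_prod_filter
    by (rule exI[of _ "\<lambda>n. 4 \<le> n"], rule exI[of _ "\<lambda>q. 2 \<le> q"])
       (auto simp: eventually_principal abs_exponent_error_le)
  then have "((\<lambda>(n, q). exponent_error n q) \<longlongrightarrow> 0) ?F"
    by (rule tendsto_0_le[OF lim, of _ 1])
  then show ?thesis by (intro smalloI_tendsto) (auto simp: case_prod_unfold)
qed

theorem theorem2p9:
  "(\<forall>n\<ge>1. \<forall>q\<ge>2. real (zimin_f n q) \<ge> zimin_lower n q) \<and>
   (\<exists>\<epsilon> :: nat \<Rightarrow> nat \<Rightarrow> real.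
      (\<forall>n\<ge>1. \<forall>q\<ge>2. zimin_lower n q = real q powr (2 ^ (n - 1) * (1 + \<epsilon> n q))) \<and>
      (\<lambda>(n, q). \<epsilon> n q) \<in> o[sequentially \<times>\<^sub>F principal {2..}](\<lambda>_. 1))"
  using zimin_f_ge_zimin_lower zimin_lower_eq_powr exponent_error_smallo by blast

end
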